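(* For every integer $k\ge1$, $$E^{(k-1)(k-2)\cdots1k}_{3\text{-}21}(x)=\begin{cases}0,&\text{if }k\ge4,\\[1mm] \dfrac{e^{e^x}}{(k-1)!}\displaystyle\int_0^x t^{k-1}e^{-e^t+t}\,dt,&\text{if }k=2\text{ or }k=3,\\[2mm] e^{e^x-1},&\text{if }k=1.\end{cases}$$
   Context: A permutation $\pi=\pi_1\cdots\pi_n$ of $\{1,\dots,n\}$ contains the generalized pattern $3\text{-}21$ if there are indices $i<j<n$ such that $\pi_i\pi_j\pi_{j+1}$ is order-isomorphic to $321$; otherwise it avoids it. A permutation $\pi$ begins with a pattern $p=p_1\cdots p_k$ if $n\ge k$ and $\pi_1\cdots\pi_k$ is order-isomorphic to $p$; by convention, the empty permutation is also regarded as beginning with the pattern $1$ (the case $k=1$). The pattern $(k-1)(k-2)\cdots1k$ consists of $k-1,k-2,\dots,1$ in decreasing order followed by $k$ (for $k=1$ it is $1$, for $k=2$ it is $12$, for $k=3$ it is $213$). $E^p_q(x)=\sum_{n\ge0}N^p_q(n)\frac{x^n}{n!}$, where $N^p_q(n)$ is the number of permutations of $\{1,\dots,n\}$ that avoid $q$ and begin with $p$. Identities are identities of power series in $x$. *)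

theory Defs
  imports
    Complex_Main
    "HOL-Computational_Algebra.Formal_Power_Series"
    "HOL-Combinatorics.Multiset_Permutations"
begin

text \<open>
  A permutation of \<open>{1..n}\<close> is represented by its one-line notation, i.e. by an element of
  \<^term>\<open>permutations_of_set {1..n::nat}\<close>. List positions count from \<open>0\<close>.
\<close>

definition order_isomorphic :: "nat list \<Rightarrow> nat list \<Rightarrow> bool" where
  "order_isomorphic xs ys \<longleftrightarrow> length xs = length ys \<and>
     (\<forall>i<length xs. \<forall>j<length xs. xs ! i < xs ! j \<longleftrightarrow> ys ! i < ys ! j)"

definition contains_3_21 :: "nat list \<Rightarrow> bool" where
  "contains_3_21 xs \<longleftrightarrow> (\<exists>i j. i < j \<and> j + 1 < length xs \<and>
     order_isomorphic [xs ! i, xs ! j, xs ! (j + 1)] [3, 2, 1])"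

text \<open>The second disjunct is the convention that the empty permutation begins with \<open>1\<close>.\<close>

definition begins_with :: "nat list \<Rightarrow> nat list \<Rightarrow> bool" where
  "begins_with xs p \<longleftrightarrow>
     (length p \<le> length xs \<and> order_isomorphic (take (length p) xs) p) \<or> (xs = [] \<and> p = [1])"

definition N_3_21 :: "nat list \<Rightarrow> nat \<Rightarrow> nat" where
  "N_3_21 p n =
     card {xs \<in> permutations_of_set {1..n}. \<not> contains_3_21 xs \<and> begins_with xs p}"

definition E_3_21 :: "nat list \<Rightarrow> real fps" where
  "E_3_21 p = Abs_fps (\<lambda>n. real (N_3_21 p n) / fact n)"

text \<open>The pattern \<open>(k-1)(k-2)\<dots>1k\<close>.\<close>

definition decr_then_max :: "nat \<Rightarrow> nat list" where
  "decr_then_max k = rev [1..<k] @ [k]"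

text \<open>
  The power series \<open>e\<^sup>F\<close> for an arbitrary real power series \<open>F\<close>. Composition of formal power series
  is only meaningful if the inner series has no constant term, so the constant term \<open>c\<close> of \<open>F\<close>
  is split off: \<open>e\<^sup>F = e\<^sup>c \<cdot> e\<^bsup>F - c\<^esup>\<close>. The lemmas below show that this is
  the unique solution of \<open>G' = F' G\<close> with \<open>G(0) = exp (F(0))\<close>, as for the function \<open>exp \<circ> f\<close>.
\<close>

definition fps_exp_comp :: "real fps \<Rightarrow> real fps" where
  "fps_exp_comp F =
     fps_const (exp (fps_nth F 0)) * (fps_exp 1 oo (F - fps_const (fps_nth F 0)))"

lemma fps_exp_comp_nth_0: "fps_nth (fps_exp_comp F) 0 = exp (fps_nth F 0)"
  by (simp add: fps_exp_comp_def)

lemma fps_deriv_fps_exp_comp: "fps_deriv (fps_exp_comp F) = fps_deriv F * fps_exp_comp F"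
  by (simp add: fps_exp_comp_def fps_compose_deriv algebra_simps)

lemma fps_exp_comp_unique:
  assumes "fps_deriv G = fps_deriv F * G" "fps_nth G 0 = exp (fps_nth F 0)"
  shows "G = fps_exp_comp F"
proof (rule fps_ext)
  fix n
  have step: "of_nat (Suc n) * fps_nth H (Suc n) = (\<Sum>i\<le>n. fps_nth (fps_deriv F) i * fps_nth H (n - i))"
    if "fps_deriv H = fps_deriv F * H" for H n
    using arg_cong[OF that, of "\<lambda>f. fps_nth f n"] by (simp add: fps_mult_nth atLeast0AtMost)
  show "fps_nth G n = fps_nth (fps_exp_comp F) n"
  proof (induction n rule: less_induct)
    case (less n)
    show ?case
    proof (cases n)
      case 0
      then show ?thesis using assms(2) by (simp add: fps_exp_comp_nth_0)
    next
      case (Suc m)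
      have "of_nat (Suc m) * fps_nth G (Suc m) = of_nat (Suc m) * fps_nth (fps_exp_comp F) (Suc m)"
        unfolding step[OF assms(1)] step[OF fps_deriv_fps_exp_comp]
        by (intro sum.cong refl arg_cong2[where f = "(*)"] less.IH) (auto simp: Suc)
      then show ?thesis unfolding Suc by (simp del: of_nat_Suc)
    qed
  qed
qed

lemma fps_exp_comp_X: "fps_exp_comp fps_X = fps_exp 1"
  by (simp add: fps_exp_comp_def)

end

theory Submission
  imports Defs
begin

text \<open>
  A permutation avoids \<open>3-21\<close> iff every descent top is a left-to-right maximum. Cutting at the
  maximum \<open>m\<close> therefore writes the avoiders uniquely as \<open>\<sigma> m \<tau>\<close> with \<open>\<sigma>\<close> an avoider on an arbitrary
  subset and \<open>\<tau>\<close> increasing. The word \<open>\<sigma> m \<tau>\<close> begins with \<open>(k-1)\<dots>1k\<close> iff \<open>\<sigma>\<close> does or \<open>\<sigma>\<close> is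
  decreasing of length \<open>k-1\<close>; hence \<open>N(n+1) = (\<Sum>j. (n choose j) N(j)) + (n choose k-1)\<close> for
  \<open>k = 2, 3\<close>, without the last summand for \<open>k = 1\<close>. In terms of generating functions this is the linear equation
  \<open>E' = e\<^sup>x E + x\<^bsup>k-1\<^esup> e\<^sup>x / (k-1)!\<close>. For \<open>k \<ge> 4\<close> the pattern itself contains \<open>3-21\<close>.
\<close>

section \<open>Avoiders cut at the maximum\<close>

text \<open>Stated over an arbitrary set of letters because the part left of the maximum is a word
  on a subset that need not be an initial segment.\<close>

definition avoiders :: "nat list \<Rightarrow> nat set \<Rightarrow> nat list set" where
  "avoiders p S = {xs \<in> permutations_of_set S. \<not> contains_3_21 xs \<and> begins_with xs p}"

lemma order_isomorphic_length_3:
  "order_isomorphic [a, b, c] [x, y, z] \<longleftrightarrow>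
    (a < b \<longleftrightarrow> x < y) \<and> (b < a \<longleftrightarrow> y < x) \<and> (a < c \<longleftrightarrow> x < z) \<and> (c < a \<longleftrightarrow> z < x) \<and>
    (b < c \<longleftrightarrow> y < z) \<and> (c < b \<longleftrightarrow> z < y)"
  by (auto simp: order_isomorphic_def All_less_Suc numeral_3_eq_3)

lemma contains_3_21_iff:
  "contains_3_21 xs \<longleftrightarrow>
    (\<exists>i j. i < j \<and> Suc j < length xs \<and> xs ! j < xs ! i \<and> xs ! Suc j < xs ! j)"
proof
  assume "\<exists>i j. i < j \<and> Suc j < length xs \<and> xs ! j < xs ! i \<and> xs ! Suc j < xs ! j"
  then obtain i j where "i < j" "Suc j < length xs" "xs ! j < xs ! i" "xs ! Suc j < xs ! j" by blast
  then show "contains_3_21 xs"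
    unfolding contains_3_21_def order_isomorphic_length_3
    by (intro exI[of _ i] exI[of _ j]) simp
qed (auto simp: contains_3_21_def order_isomorphic_length_3)

text \<open>The letter \<open>m\<close> can act only as the 3. It precedes all of \<open>t\<close>,
  so every descent inside \<open>t\<close> completes an occurrence; the step into \<open>m\<close>
  is an ascent, and the step out of \<open>m\<close> has nothing larger before it.\<close>

lemma contains_3_21_append_max_iff:
  assumes "\<And>x. x \<in> set s \<Longrightarrow> x < m" "\<And>x. x \<in> set t \<Longrightarrow> x < m"
  shows "contains_3_21 (s @ m # t) \<longleftrightarrow> contains_3_21 s \<or> \<not> sorted t"
proof
  assume "contains_3_21 s \<or> \<not> sorted t"
  then show "contains_3_21 (s @ m # t)"
  proof
    assume "contains_3_21 s"
    then obtain i j where "i < j" "Suc j < length s" "s ! j < s ! i" "s ! Suc j < s ! j"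
      by (auto simp: contains_3_21_iff)
    then show ?thesis
      unfolding contains_3_21_iff
      by (intro exI[of _ i] exI[of _ j]) (simp add: nth_append)
  next
    assume "\<not> sorted t"
    then obtain j where "Suc j < length t" "t ! Suc j < t ! j"
      by (auto simp: sorted_iff_nth_Suc not_le)
    then show ?thesis
      using assms(2)[of "t ! j"] unfolding contains_3_21_iff
      by (intro exI[of _ "length s"] exI[of _ "length s + Suc j"]) (simp add: nth_append)
  qed
next
  let ?xs = "s @ m # t"
  assume "contains_3_21 ?xs"
  then obtain i j where ij: "i < j" "Suc j < length ?xs" "?xs ! j < ?xs ! i" "?xs ! Suc j < ?xs ! j"
    by (auto simp: contains_3_21_iff)
  \<comment> \<open>Cases on the position of the middle letter. If it is the last letter of
    \<open>s\<close>, or \<open>m\<close> itself, no occurrence is possible.\<close>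
  consider "Suc j < length s" | "Suc j = length s" | "j = length s" | d where "j = length s + Suc d"
    by (metis Suc_lessI less_imp_add_positive linorder_neqE_nat not0_implies_Suc less_irrefl)
  then show "contains_3_21 s \<or> \<not> sorted t"
  proof cases
    case 1
    with ij have "contains_3_21 s"
      unfolding contains_3_21_iff by (intro exI[of _ i] exI[of _ j]) (simp add: nth_append)
    then show ?thesis ..
  next
    case 2
    then have "s ! j < m" by (intro assms(1)) (auto intro: nth_mem)
    with ij 2 show ?thesis by (simp add: nth_append split: if_splits)
  next
    case 3
    then have "s ! i < m" using ij by (intro assms(1)) (auto intro: nth_mem)
    with ij 3 show ?thesis by (simp add: nth_append split: if_splits)
  next
    case 4
    with ij have "Suc d < length t" "t ! Suc d < t ! d"
      by (simp_all add: nth_append)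
    then show ?thesis by (auto simp: sorted_iff_nth_Suc not_le)
  qed
qed

text \<open>\<open>T\<close> is the set of letters left of \<open>m\<close>; the remaining letters
  are forced into increasing order. The prefix condition stays on the whole word, since the pattern
  may reach \<open>m\<close> or go beyond it.\<close>

lemma avoiders_cut_at_max:
  assumes S: "finite S" and m: "\<And>x. x \<in> S \<Longrightarrow> x < m"
  shows "avoiders p (insert m S) =
    (\<lambda>(T, s). s @ m # sorted_list_of_set (S - T)) `
      (SIGMA T:Pow S. {s \<in> permutations_of_set T. \<not> contains_3_21 s \<and>
         begins_with (s @ m # sorted_list_of_set (S - T)) p})"
    (is "_ = ?f ` ?D")
proof (intro equalityI subsetI)
  fix xs assume "xs \<in> avoiders p (insert m S)"
  then have xs: "set xs = insert m S" "distinct xs" "\<not> contains_3_21 xs" "begins_with xs p"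
    by (auto simp: avoiders_def permutations_of_set_def)
  then obtain s t where st: "xs = s @ m # t" by (metis insertI1 split_list)
  have disj: "set s \<inter> set t = {}" "m \<notin> set s" "m \<notin> set t" "distinct s" "distinct t"
    using xs st by auto
  have "m \<notin> S" using m by blast
  with xs(1) st disj have S_eq: "S = set s \<union> set t" by auto
  with disj have t: "S - set s = set t" by auto
  have "\<not> contains_3_21 s" "sorted t"
    using xs(3) st m S_eq by (auto simp: contains_3_21_append_max_iff)
  with disj t have "sorted_list_of_set (S - set s) = t"
    by (simp add: sorted_list_of_set.idem_if_sorted_distinct)
  with xs st disj S_eq \<open>\<not> contains_3_21 s\<close> show "xs \<in> ?f ` ?D"
    by (intro image_eqI[of _ _ "(set s, s)"]) (auto simp: permutations_of_set_def)
next
  fix xs assume "xs \<in> ?f ` ?D"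
  then obtain T s where Ts: "xs = s @ m # sorted_list_of_set (S - T)" "T \<subseteq> S"
    "set s = T" "distinct s" "\<not> contains_3_21 s" "begins_with xs p"
    by (auto simp: permutations_of_set_def)
  have "m \<notin> S" using m by blast
  have "\<not> contains_3_21 xs"
    unfolding Ts(1) using Ts m S by (subst contains_3_21_append_max_iff) auto
  with Ts S \<open>m \<notin> S\<close> show "xs \<in> avoiders p (insert m S)"
    by (auto simp: avoiders_def permutations_of_set_def)
qed

text \<open>Here \<open>c\<close> stands for the surplus of words that begin with \<open>p\<close>
  only once \<open>m\<close> and the tail are attached. The hypothesis \<open>prefix\<close> ranges
  over every tail \<open>t\<close> because the tail varies with \<open>T\<close>.\<close>

lemma card_avoiders_insert_max:
  assumes S: "finite S" and m: "\<And>x. x \<in> S \<Longrightarrow> x < m"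
    and prefix: "\<And>T t. finite T \<Longrightarrow> (\<And>x. x \<in> T \<union> set t \<Longrightarrow> x < m) \<Longrightarrow>
      card {s \<in> permutations_of_set T. \<not> contains_3_21 s \<and> begins_with (s @ m # t) p} =
        card (avoiders p T) + c (card T)"
  shows "card (avoiders p (insert m S)) = (\<Sum>T\<in>Pow S. card (avoiders p T) + c (card T))"
proof -
  let ?f = "\<lambda>(T, s). s @ m # sorted_list_of_set (S - T)"
  let ?B = "\<lambda>T. {s \<in> permutations_of_set T. \<not> contains_3_21 s \<and>
         begins_with (s @ m # sorted_list_of_set (S - T)) p}"
  have "inj_on ?f (Sigma (Pow S) ?B)"
  proof (rule inj_onI, clarsimp)
    fix T s T' s'
    assume *: "T \<subseteq> S" "T' \<subseteq> S" "s \<in> permutations_of_set T" "s' \<in> permutations_of_set T'"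
      "s @ m # sorted_list_of_set (S - T) = s' @ m # sorted_list_of_set (S - T')"
    \<comment> \<open>A word containing \<open>m\<close> exactly once is cut at \<open>m\<close> in
      only one way, and \<open>T\<close> is recovered as \<open>set s\<close>.\<close>
    have "m \<notin> S" using m by blast
    with * have "m \<notin> set s" "m \<notin> set s'" by (auto simp: permutations_of_set_def)
    moreover have "m \<notin> set (sorted_list_of_set (S - T))" using \<open>m \<notin> S\<close> S by simp
    ultimately have "s = s'"
      using *(5) append_Cons_eq_iff by metis
    with * show "T = T' \<and> s = s'" by (auto simp: permutations_of_set_def)
  qed
  then have "card (avoiders p (insert m S)) = card (Sigma (Pow S) ?B)"
    by (subst avoiders_cut_at_max[OF S m]) (auto intro: card_image)
  also have "\<dots> = (\<Sum>T\<in>Pow S. card (?B T))"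
    using S by (subst card_SigmaI) (auto intro: finite_subset)
  also have "\<dots> = (\<Sum>T\<in>Pow S. card (avoiders p T) + c (card T))"
    using S m by (intro sum.cong refl prefix) (auto intro: finite_subset)
  finally show ?thesis .
qed

section \<open>The binomial recursion for the counts\<close>

lemma sum_Pow_card:
  fixes g :: "nat \<Rightarrow> nat"
  assumes "finite S"
  shows "(\<Sum>T\<in>Pow S. g (card T)) = (\<Sum>j\<le>card S. (card S choose j) * g j)"
proof -
  have "(\<Sum>T\<in>Pow S. g (card T)) = (\<Sum>j\<le>card S. \<Sum>T\<in>{T \<in> Pow S. card T = j}. g (card T))"
    using assms by (subst sum.group) (auto intro: card_mono)
  also have "\<dots> = (\<Sum>j\<le>card S. (card S choose j) * g j)"
    using assms by (intro sum.cong refl) (simp add: n_subsets)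
  finally show ?thesis .
qed

text \<open>Invariance under relabelling comes from the recursion itself, without a standardization
  bijection: by strong induction the sum over subsets depends only on their sizes, so any two sets
  of equal size get the same value.\<close>

lemma
  assumes prefix: "\<And>T m t. finite T \<Longrightarrow> (\<And>x. x \<in> T \<union> set t \<Longrightarrow> x < m) \<Longrightarrow>
      card {s \<in> permutations_of_set T. \<not> contains_3_21 s \<and> begins_with (s @ m # t) p} =
        card (avoiders p T) + c (card T)"
  shows card_avoiders: "finite S \<Longrightarrow> card (avoiders p S) = N_3_21 p (card S)"
    and N_3_21_Suc: "N_3_21 p (Suc n) = (\<Sum>j\<le>n. (n choose j) * (N_3_21 p j + c j))"
proof -
  \<comment> \<open>Invariance is assumed only for sets smaller than \<open>S\<close>. This version
    therefore serves inside the induction and, once invariance is established, again for the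
    recursion of \<open>N_3_21\<close>.\<close>
  have rec: "card (avoiders p S) = (\<Sum>j\<le>n. (n choose j) * (N_3_21 p j + c j))"
    if IH: "\<And>T. finite T \<Longrightarrow> card T < Suc n \<Longrightarrow> card (avoiders p T) = N_3_21 p (card T)"
      and S: "finite S" "card S = Suc n" for S n
  proof -
    define R where "R = S - {Max S}"
    have "Max S \<in> S" using S by (intro Max_in) auto
    then have R: "S = insert (Max S) R" "finite R" "card R = n"
      using S by (auto simp: R_def)
    have less: "x < Max S" if "x \<in> R" for x
      using that S Max_ge[of S x] by (auto simp: R_def order_le_less)
    have "card (avoiders p S) = (\<Sum>T\<in>Pow R. card (avoiders p T) + c (card T))"
      by (subst R(1), rule card_avoiders_insert_max) (use R less prefix in auto)
    also have "\<dots> = (\<Sum>T\<in>Pow R. N_3_21 p (card T) + c (card T))"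
      using R card_mono[OF R(2)]
      by (intro sum.cong refl arg_cong2[where f = "(+)"] IH)
        (auto intro: finite_subset simp: less_Suc_eq_le)
    also have "\<dots> = (\<Sum>j\<le>n. (n choose j) * (N_3_21 p j + c j))"
      using sum_Pow_card[OF R(2), of "\<lambda>j. N_3_21 p j + c j"] R by simp
    finally show ?thesis .
  qed
  have N: "N_3_21 p n = card (avoiders p {1..n})" for n
    by (simp add: N_3_21_def avoiders_def)
  have *: "card (avoiders p S) = N_3_21 p (card S)" if "finite S" for S
    using that
  proof (induction "card S" arbitrary: S rule: less_induct)
    case less
    show ?case
    proof (cases "card S")
      case 0
      with less show ?thesis by (simp add: N)
    next
      case (Suc n)
      have IH: "card (avoiders p T) = N_3_21 p (card T)" if "finite T" "card T < Suc n" for T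
        using less.hyps[of T] that Suc by simp
      show ?thesis
        using rec[OF IH, of n S] rec[OF IH, of n "{1..Suc n}"] Suc less.prems by (simp add: N)
    qed
  qed
  show "finite S \<Longrightarrow> card (avoiders p S) = N_3_21 p (card S)" by (rule *)
  show "N_3_21 p (Suc n) = (\<Sum>j\<le>n. (n choose j) * (N_3_21 p j + c j))"
    using rec[OF *, of n "{1..Suc n}"] by (simp add: N)
qed

section \<open>Initial patterns\<close>

lemma begins_with_1: "begins_with xs [1]"
  by (cases xs) (auto simp: begins_with_def order_isomorphic_def)

lemma begins_with_12: "begins_with xs [1, 2] \<longleftrightarrow> (\<exists>a b ys. xs = a # b # ys \<and> a < b)"
  by (cases xs; cases "tl xs")
    (auto simp: begins_with_def order_isomorphic_def All_less_Suc numeral_2_eq_2)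

lemma begins_with_213:
  "begins_with xs [2, 1, 3] \<longleftrightarrow> (\<exists>a b c ys. xs = a # b # c # ys \<and> b < a \<and> a < c)"
  by (cases xs; cases "tl xs"; cases "tl (tl xs)")
    (auto simp: begins_with_def order_isomorphic_length_3)

lemma not_contains_3_21_short: "length xs < 3 \<Longrightarrow> \<not> contains_3_21 xs"
  by (auto simp: contains_3_21_iff)

lemma card_prefix_1:
  "card {s \<in> permutations_of_set T. \<not> contains_3_21 s \<and> begins_with (s @ m # t) [1]} =
    card (avoiders [1] T) + 0"
  by (simp add: avoiders_def begins_with_1 del: One_nat_def)

text \<open>Two letters of \<open>s\<close> decide the matter. A single letter is followed by the
  larger \<open>m\<close>, which is the surplus; if \<open>s\<close> is empty, the word starts with
  its maximum and cannot begin with an ascent.\<close>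

lemma card_prefix_12:
  assumes "finite T" "\<And>x. x \<in> T \<union> set t \<Longrightarrow> x < m"
  shows "card {s \<in> permutations_of_set T. \<not> contains_3_21 s \<and> begins_with (s @ m # t) [1, 2]} =
    card (avoiders [1, 2] T) + (if card T = 1 then 1 else 0)"
    (is "card ?B = _")
proof (cases "card T = 1")
  case True
  then obtain a where T: "T = {a}" by (auto simp: card_1_singleton_iff)
  have "?B = {[a]}" using assms T
    by (auto simp: begins_with_12 not_contains_3_21_short simp del: One_nat_def)
  moreover have "avoiders [1, 2] T = {}"
    by (auto simp: avoiders_def begins_with_12 T simp del: One_nat_def)
  ultimately show ?thesis using True by simp
next
  case False
  have "begins_with (s @ m # t) [1, 2] \<longleftrightarrow> begins_with s [1, 2]"
    if s: "s \<in> permutations_of_set T" for s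
  proof -
    have "length s \<noteq> 1" using False s by (simp add: length_finite_permutations_of_set)
    then consider "s = []" | a b ys where "s = a # b # ys"
      by (cases s; cases "tl s") auto
    then show ?thesis
      by cases (use assms(2) in \<open>force simp: begins_with_12 simp del: One_nat_def\<close>)+
  qed
  then have "?B = avoiders [1, 2] T" by (auto simp: avoiders_def)
  with False show ?thesis by simp
qed

text \<open>The surplus is the decreasing arrangement of two letters, completed by \<open>m\<close>.
  A single letter before \<open>m\<close> gives an initial ascent, and an empty \<open>s\<close>
  puts the maximum first; neither fits 213.\<close>

lemma card_prefix_213:
  assumes "finite T" "\<And>x. x \<in> T \<union> set t \<Longrightarrow> x < m"
  shows "card {s \<in> permutations_of_set T. \<not> contains_3_21 s \<and> begins_with (s @ m # t) [2, 1, 3]} =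
    card (avoiders [2, 1, 3] T) + (if card T = 2 then 1 else 0)"
    (is "card ?B = _")
proof (cases "card T = 2")
  case True
  then obtain a b where T: "T = {a, b}" "b < a"
    by (metis card_2_iff insert_commute linorder_neqE_nat)
  have short: "length s = 2" if "s \<in> permutations_of_set T" for s
    using that True by (simp add: length_finite_permutations_of_set)
  have "[a, b] \<in> permutations_of_set T" using T by (auto simp: permutations_of_set_def)
  moreover have "s = [a, b]" if "s \<in> permutations_of_set T" "begins_with (s @ m # t) [2, 1, 3]" for s
  proof -
    from short[OF that(1)] obtain c d where "s = [c, d]"
      by (auto simp: numeral_2_eq_2 length_Suc_conv)
    with that T show ?thesis
      by (auto simp: begins_with_213 permutations_of_set_def doubleton_eq_iff
          simp del: One_nat_def)
  qed
  moreover have "begins_with ([a, b] @ m # t) [2, 1, 3]"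
    using T assms(2)[of a] by (auto simp: begins_with_213 simp del: One_nat_def)
  moreover have "\<not> contains_3_21 [a, b]" by (rule not_contains_3_21_short) simp
  ultimately have "?B = {[a, b]}" by blast
  moreover have "avoiders [2, 1, 3] T = {}"
    using short by (fastforce simp: avoiders_def begins_with_213 simp del: One_nat_def)
  ultimately show ?thesis using True by simp
next
  case False
  have "begins_with (s @ m # t) [2, 1, 3] \<longleftrightarrow> begins_with s [2, 1, 3]"
    if s: "s \<in> permutations_of_set T" for s
  proof -
    have sub: "set s \<subseteq> T" using s by (auto simp: permutations_of_set_def)
    have "length s \<noteq> 2" using False s by (simp add: length_finite_permutations_of_set)
    then consider "s = []" | a where "s = [a]" | a b c ys where "s = a # b # c # ys"
      by (cases s; cases "tl s"; cases "tl (tl s)") auto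
    then show ?thesis
      by cases (use assms(2) sub in \<open>force simp: begins_with_213 simp del: One_nat_def\<close>)+
  qed
  then have "?B = avoiders [2, 1, 3] T" by (auto simp: avoiders_def)
  with False show ?thesis by simp
qed

section \<open>The empty permutation, and the patterns with \<open>k \<ge> 4\<close>\<close>

lemma N_3_21_0: "p \<noteq> [] \<Longrightarrow> N_3_21 p 0 = (if p = [1] then 1 else 0)"
proof -
  assume "p \<noteq> []"
  then have "{xs \<in> permutations_of_set {1..0}. \<not> contains_3_21 xs \<and> begins_with xs p} =
      (if p = [1] then {[]} else {})"
    by (auto simp: begins_with_def contains_3_21_iff)
  then show ?thesis by (simp add: N_3_21_def)
qed

lemma N_3_21_decr_then_max_ge_4:
  assumes "k \<ge> 4"
  shows "N_3_21 (decr_then_max k) n = 0"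
proof -
  let ?p = "decr_then_max k"
  have len: "length ?p = k" using assms by (simp add: decr_then_max_def)
  \<comment> \<open>Since \<open>k - 1 \<ge> 3\<close>, the first three entries lie in the
    decreasing part; they supply the 3-21 occurrence at positions 0, 1, 2.\<close>
  have p: "?p ! i = k - Suc i" if "i < 3" for i
    using that assms by (auto simp: decr_then_max_def nth_append rev_nth)
  have "contains_3_21 xs" if "begins_with xs ?p" for xs
  proof -
    have k: "k \<le> length xs" "order_isomorphic (take k xs) ?p"
      using that assms len by (auto simp: begins_with_def)
    then have iso: "xs ! i < xs ! j \<longleftrightarrow> ?p ! i < ?p ! j" if "i < 3" "j < 3" for i j
      using that assms len by (auto simp: order_isomorphic_def)
    have "xs ! 1 < xs ! 0" "xs ! 2 < xs ! 1"
      using iso[of 1 0] iso[of 2 1] p[of 0] p[of 1] p[of 2] assms by linarith+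
    moreover have "Suc 1 < length xs" using k(1) assms by linarith
    ultimately show ?thesis
      unfolding contains_3_21_iff
      by (intro exI[of _ 0] exI[of _ 1]) (simp add: numeral_2_eq_2)
  qed
  then show ?thesis by (auto simp: N_3_21_def)
qed

section \<open>The generating functions\<close>

lemma fps_exp_comp_add: "fps_exp_comp (F + G) = fps_exp_comp F * fps_exp_comp G"
  by (rule fps_exp_comp_unique[symmetric])
    (simp_all add: fps_deriv_fps_exp_comp fps_exp_comp_nth_0 exp_add algebra_simps)

lemma fps_linear_ode_unique:
  fixes F G H R :: "real fps"
  assumes "fps_deriv G = fps_deriv F * G + R" "fps_deriv H = fps_deriv F * H + R"
    and "fps_nth G 0 = fps_nth H 0"
  shows "G = H"
proof -
  \<comment> \<open>The difference \<open>G - H\<close> solves the homogeneous equation with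
    constant term 0, whereas the uniqueness lemma needs the constant term of \<open>e^F\<close>;
    adding \<open>e^F\<close> repairs this.\<close>
  have "G - H + fps_exp_comp F = fps_exp_comp F"
    using assms
    by (intro fps_exp_comp_unique)
      (simp_all add: fps_deriv_fps_exp_comp fps_exp_comp_nth_0 algebra_simps)
  then show ?thesis by simp
qed

text \<open>Turns the surplus \<open>n choose r\<close> of the recursion into the inhomogeneous term
  of the differential equation.\<close>

lemma fps_nth_X_power_mult_exp:
  "fps_nth (fps_const (1 / fact r) * fps_X ^ r * fps_exp 1) n = real (n choose r) / fact n"
  by (auto simp: mult.assoc fps_X_power_mult_nth binomial_fact)

text \<open>For exponential generating functions, differentiation shifts the index and
  multiplication by \<open>e^x\<close> is the binomial transform.\<close>

lemma fps_deriv_E_3_21: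
  assumes "\<And>n. N_3_21 p (Suc n) = (\<Sum>j\<le>n. (n choose j) * N_3_21 p j) + b n"
  shows "fps_deriv (E_3_21 p) = fps_exp 1 * E_3_21 p + Abs_fps (\<lambda>n. real (b n) / fact n)"
proof (rule fps_ext)
  fix n
  have "fps_nth (fps_exp 1 * E_3_21 p) n =
      (\<Sum>j\<le>n. real (N_3_21 p j) / (fact j * fact (n - j)))"
    by (subst mult.commute) (simp add: fps_mult_nth E_3_21_def atLeast0AtMost)
  also have "\<dots> = real (\<Sum>j\<le>n. (n choose j) * N_3_21 p j) / fact n"
    by (auto simp: sum_divide_distrib binomial_fact intro!: sum.cong)
  finally show "fps_nth (fps_deriv (E_3_21 p)) n =
      fps_nth (fps_exp 1 * E_3_21 p + Abs_fps (\<lambda>n. real (b n) / fact n)) n"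
    by (simp add: E_3_21_def assms field_simps del: of_nat_Suc)
qed

lemma E_3_21_1: "E_3_21 [1] = fps_exp_comp (fps_exp 1 - 1)"
proof (rule fps_exp_comp_unique)
  have "N_3_21 [1] (Suc n) = (\<Sum>j\<le>n. (n choose j) * N_3_21 [1] j) + 0" for n
    using N_3_21_Suc[of "[1]" "\<lambda>_. 0", OF card_prefix_1] by simp
  from fps_deriv_E_3_21[OF this]
  show "fps_deriv (E_3_21 [1]) = fps_deriv (fps_exp 1 - 1) * E_3_21 [1]"
    by (simp add: fps_zero_def[symmetric])
qed (simp add: E_3_21_def N_3_21_0)

text \<open>Variation of constants: \<open>e^(e^x)\<close> solves the homogeneous equation, and the
  integrand is the inhomogeneous term divided by it, up to the factor
  \<open>1 / fact r\<close>.\<close>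

lemma E_3_21_integral:
  assumes prefix: "\<And>T m t. finite T \<Longrightarrow> (\<And>x. x \<in> T \<union> set t \<Longrightarrow> x < m) \<Longrightarrow>
      card {s \<in> permutations_of_set T. \<not> contains_3_21 s \<and> begins_with (s @ m # t) p} =
        card (avoiders p T) + (if card T = r then 1 else 0)"
    and p: "p \<noteq> []" "p \<noteq> [1]"
  shows "E_3_21 p = fps_const (1 / fact r) * fps_exp_comp (fps_exp 1) *
    fps_integral0 (fps_X ^ r * fps_exp_comp (- fps_exp 1 + fps_X))"
proof (rule fps_linear_ode_unique)
  let ?R = "fps_const (1 / fact r) * fps_X ^ r * fps_exp 1 :: real fps"
  have rec: "N_3_21 p (Suc n) = (\<Sum>j\<le>n. (n choose j) * N_3_21 p j) + (n choose r)" for n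
  proof -
    have "N_3_21 p (Suc n) = (\<Sum>j\<le>n. (n choose j) * (N_3_21 p j + (if j = r then 1 else 0)))"
      by (rule N_3_21_Suc[OF prefix])
    \<comment> \<open>Only \<open>j = r\<close> contributes; for \<open>r > n\<close> the sum is
      empty of such terms and \<open>n choose r\<close> vanishes as well.\<close>
    also have "\<dots> = (\<Sum>j\<le>n. (n choose j) * N_3_21 p j) + (\<Sum>j\<le>n. if j = r then n choose j else 0)"
      unfolding sum.distrib[symmetric] by (intro sum.cong) auto
    finally show ?thesis by (simp add: binomial_eq_0)
  qed
  have "?R = Abs_fps (\<lambda>n. real (n choose r) / fact n)"
    by (rule fps_ext) (simp add: fps_nth_X_power_mult_exp)
  then show "fps_deriv (E_3_21 p) = fps_deriv (fps_exp 1) * E_3_21 p + ?R"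
    using fps_deriv_E_3_21[OF rec] by simp
  \<comment> \<open>The outer factor cancels against the integrand and leaves \<open>e^x\<close>, so
    differentiating the integral produces exactly \<open>?R\<close>.\<close>
  have "fps_exp_comp (fps_exp 1) * fps_exp_comp (- fps_exp 1 + fps_X) = fps_exp 1"
    unfolding fps_exp_comp_add[symmetric] by (simp add: fps_exp_comp_X)
  then have "?R = fps_const (1 / fact r) * fps_X ^ r *
      (fps_exp_comp (fps_exp 1) * fps_exp_comp (- fps_exp 1 + fps_X))"
    by simp
  then show "fps_deriv (fps_const (1 / fact r) * fps_exp_comp (fps_exp 1) *
      fps_integral0 (fps_X ^ r * fps_exp_comp (- fps_exp 1 + fps_X))) =
    fps_deriv (fps_exp 1) * (fps_const (1 / fact r) * fps_exp_comp (fps_exp 1) *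
      fps_integral0 (fps_X ^ r * fps_exp_comp (- fps_exp 1 + fps_X))) + ?R"
    by (simp add: fps_deriv_fps_exp_comp fps_deriv_fps_integral mult_ac)
\<comment> \<open>Both constant terms are 0: the integral starts at 0, and the empty permutation
  begins with no nonempty pattern other than \<open>[1]\<close>.\<close>
qed (use p in \<open>simp add: E_3_21_def N_3_21_0\<close>)

theorem proposition27:
  fixes k :: nat
  assumes "k \<ge> 1"
  shows "E_3_21 (decr_then_max k) =
    (if k \<ge> 4 then 0
     else if k = 2 \<or> k = 3 then
       fps_const (1 / fact (k - 1)) * fps_exp_comp (fps_exp 1) *
       fps_integral0 (fps_X ^ (k - 1) * fps_exp_comp (- fps_exp 1 + fps_X))
     else fps_exp_comp (fps_exp 1 - 1))"
proof -
  consider "k \<ge> 4" | "k = 1" | "k = 2" | "k = 3" using assms by linarith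
  then show ?thesis
  proof cases
    case 1
    then show ?thesis by (simp add: E_3_21_def N_3_21_decr_then_max_ge_4 fps_zero_def)
  next
    case 2
    then show ?thesis using E_3_21_1 by (simp add: decr_then_max_def)
  next
    case 3
    then have "decr_then_max k = [1, 2]" by (simp add: decr_then_max_def numeral_2_eq_2)
    with 3 E_3_21_integral[OF card_prefix_12] show ?thesis by simp
  next
    case 4
    then have "decr_then_max k = [2, 1, 3]" by (simp add: decr_then_max_def upt_rec numeral_3_eq_3)
    with 4 E_3_21_integral[OF card_prefix_213] show ?thesis by simp
  qed
qed

end
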